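(* Let $a,b$ be nonzero real numbers, let $(\mathcal{F}_n(a,b))$ be the bi-periodic Fibonacci matrix sequence and $(\mathcal{L}_n(a,b))$ the bi-periodic Lucas matrix sequence. Then for all $m,n,r\in\mathbb{N}$ with $n\ge r$: (i) $\displaystyle \mathcal{F}_n^m(a,b)=\left(\frac{b}{a}\right)^{\lfloor m/2\rfloor\,\varepsilon(n)}\mathcal{F}_{mn}(a,b)$; (ii) $\displaystyle \mathcal{F}_{n+1}^m(a,b)=\left(\frac{a}{b}\right)^{\lfloor (m+1)/2\rfloor\,\varepsilon(n)}\mathcal{F}_1^m(a,b)\,\mathcal{F}_{mn}(a,b)$; (iii) $\displaystyle \mathcal{F}_{n-r}(a,b)\mathcal{F}_{n+r}(a,b)=\left(\frac{b}{a}\right)^{\varepsilon(n-r)}\mathcal{F}_2^n(a,b)=\left(\frac{b}{a}\right)^{(-1)^n\varepsilon(r)}\mathcal{F}_n^2(a,b)$; (iv) $\displaystyle \mathcal{L}_{n-r}(a,b)\mathcal{L}_{n+r}(a,b)=\left(\frac{a}{b}\right)^{(-1)^n\varepsilon(r)}\mathcal{L}_n^2(a,b)$; (v) $\displaystyle \mathcal{L}_0^m(a,b)\,\mathcal{F}_{mn}(a,b)=\left(\frac{b}{a}\right)^{\lfloor (m+1)/2\rfloor\,\varepsilon(n)}\mathcal{L}_n^m(a,b)$.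
   Context: Let $a,b$ be nonzero real numbers and $\mathbb{N}=\{0,1,2,\dots\}$. Put $\varepsilon(n)=1$ if $n$ is odd and $\varepsilon(n)=0$ if $n$ is even. For a matrix sequence, $\mathcal{F}_n^m(a,b)$ denotes the $m$-th matrix power of $\mathcal{F}_n(a,b)$, and similarly for $\mathcal{L}$. The bi-periodic Fibonacci numbers are defined by $q_0=0$, $q_1=1$, and $q_n=a\,q_{n-1}+q_{n-2}$ if $n$ is even, $q_n=b\,q_{n-1}+q_{n-2}$ if $n$ is odd; the recurrence at $n=1$ gives $q_{-1}=1$. The bi-periodic Fibonacci matrix sequence is, for $n\ge0$, $$\mathcal{F}_n(a,b)=\begin{pmatrix} \left(\frac{b}{a}\right)^{\varepsilon(n)} q_{n+1} & \frac{b}{a}\,q_n\\ q_n & \left(\frac{b}{a}\right)^{\varepsilon(n)} q_{n-1}\end{pmatrix}.$$ The bi-periodic Lucas matrix sequence is defined by $$\mathcal{L}_0(a,b)=\begin{pmatrix} a & 2\\ 2\frac{a}{b} & -a\end{pmatrix},\qquad \mathcal{L}_1(a,b)=\begin{pmatrix} a^2+2\frac{a}{b} & a\\ \frac{a^2}{b} & 2\frac{a}{b}\end{pmatrix},$$ and for $n\ge 2$, $\mathcal{L}_n(a,b)=a\,\mathcal{L}_{n-1}(a,b)+\mathcal{L}_{n-2}(a,b)$ if $n$ is odd, $\mathcal{L}_n(a,b)=b\,\mathcal{L}_{n-1}(a,b)+\mathcal{L}_{n-2}(a,b)$ if $n$ is even. *)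

theory Defs
  imports Complex_Main "Jordan_Normal_Form.Matrix"
begin

definition eps :: "nat \<Rightarrow> nat" where
  "eps n = (if odd n then 1 else 0)"

fun biperiodic_fib :: "real \<Rightarrow> real \<Rightarrow> nat \<Rightarrow> real" where
  "biperiodic_fib a b 0 = 0"
| "biperiodic_fib a b (Suc 0) = 1"
| "biperiodic_fib a b (Suc (Suc n)) =
     (if even (Suc (Suc n)) then a else b) * biperiodic_fib a b (Suc n) + biperiodic_fib a b n"

text \<open>The sequence \<open>q\<close> with the additional index \<open>-1\<close>, where \<open>q\<^sub>-\<^sub>1 = 1\<close> is forced by the
  recurrence at \<open>n = 1\<close>. Indices below \<open>-1\<close> carry no meaning and are never used.\<close>

definition biperiodic_fib_int :: "real \<Rightarrow> real \<Rightarrow> int \<Rightarrow> real" where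
  "biperiodic_fib_int a b k = (if k = -1 then 1 else biperiodic_fib a b (nat k))"

lemma biperiodic_fib_int_rec:
  assumes "k \<ge> 1"
  shows "biperiodic_fib_int a b k =
    (if even k then a else b) * biperiodic_fib_int a b (k - 1) + biperiodic_fib_int a b (k - 2)"
proof (cases "k = 1")
  case True
  then show ?thesis by (simp add: biperiodic_fib_int_def)
next
  case False
  with assms have "k \<ge> 2" by simp
  then obtain n where n: "k = int n + 2"
    by (metis add.commute zle_iff_zadd)
  have "nat k = Suc (Suc n)" "nat (k - 1) = Suc n" "nat (k - 2) = n" using n by auto
  then show ?thesis using n by (simp add: biperiodic_fib_int_def)
qed

definition fib_mat :: "real \<Rightarrow> real \<Rightarrow> nat \<Rightarrow> real mat" where
  "fib_mat a b n = mat_of_rows_list 2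
     [[(b / a) ^ eps n * biperiodic_fib_int a b (int n + 1), (b / a) * biperiodic_fib_int a b (int n)],
      [biperiodic_fib_int a b (int n), (b / a) ^ eps n * biperiodic_fib_int a b (int n - 1)]]"

fun lucas_mat :: "real \<Rightarrow> real \<Rightarrow> nat \<Rightarrow> real mat" where
  "lucas_mat a b 0 = mat_of_rows_list 2
     [[a, 2],
      [2 * (a / b), - a]]"
| "lucas_mat a b (Suc 0) = mat_of_rows_list 2
     [[a\<^sup>2 + 2 * (a / b), a],
      [a\<^sup>2 / b, 2 * (a / b)]]"
| "lucas_mat a b (Suc (Suc n)) =
     (if odd (Suc (Suc n)) then a else b) \<cdot>\<^sub>m lucas_mat a b (Suc n) + lucas_mat a b n"

end

theory Submission
  imports Defs
begin

text \<open>Write \<open>c = b / a\<close>. Both sequences consist of scaled powers of the single matrix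
  \<open>\<F>\<^sub>1\<close>, namely \<open>\<F>\<^sub>1\<^sup>n = c\<^bsup>\<lfloor>n/2\<rfloor>\<^esup> \<F>\<^sub>n\<close> and
  \<open>\<L>\<^sub>0 \<F>\<^sub>1\<^sup>n = c\<^bsup>\<lfloor>(n+1)/2\<rfloor>\<^esup> \<L>\<^sub>n\<close>, and \<open>\<L>\<^sub>0\<close> commutes with
  \<open>\<F>\<^sub>1\<close>. So both sides of each identity are scalar multiples of the same product
  \<open>\<L>\<^sub>0\<^sup>i \<F>\<^sub>1\<^sup>j\<close>, and only the exponents of \<open>c\<close> have to be compared.\<close>

section \<open>Scalar multiples and powers of square matrices\<close>

lemma smult_smult_mat: "k \<cdot>\<^sub>m (l \<cdot>\<^sub>m A) = (k * l :: 'a :: semigroup_mult) \<cdot>\<^sub>m A"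
  by (intro eq_matI) (auto simp: mult.assoc)

lemma one_smult_mat [simp]: "(1 :: 'a :: monoid_mult) \<cdot>\<^sub>m A = A"
  by (intro eq_matI) auto

context
  fixes A :: "'a :: comm_semiring_1 mat" and d :: nat
  assumes A: "A \<in> carrier_mat d d"
begin

text \<open>Square matrices of a fixed dimension form a HOL-Algebra \<open>semiring\<close> whose
  monoid power is the matrix power (\<open>pow_mat_ring_pow\<close>), so the monoid law transfers.
  The other power laws of this context, except the one for scalar factors, are obtained the same
  way.\<close>

lemma pow_mat_add: "A ^\<^sub>m i * A ^\<^sub>m j = A ^\<^sub>m (i + j)"
proof -
  interpret M: semiring "ring_mat TYPE('a) d ()" by (rule semiring_mat)
  show ?thesis
    using M.nat_pow_mult[of A i j] A
    by (simp add: pow_mat_ring_pow[OF A, where b = "()"] ring_mat_simps)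
qed

lemma pow_mat_pow: "(A ^\<^sub>m i) ^\<^sub>m j = A ^\<^sub>m (i * j)"
proof -
  interpret M: semiring "ring_mat TYPE('a) d ()" by (rule semiring_mat)
  have "A ^\<^sub>m i \<in> carrier_mat d d" using A by simp
  then show ?thesis
    using M.nat_pow_pow[of A i j] A
    by (simp add: pow_mat_ring_pow[where n = d and b = "()"] ring_mat_simps)
qed

lemma pow_mat_smult: "(k \<cdot>\<^sub>m A) ^\<^sub>m i = k ^ i \<cdot>\<^sub>m A ^\<^sub>m i"
proof (induction i)
  case 0
  show ?case by (intro eq_matI) auto
next
  case (Suc i)
  have "k ^ i \<cdot>\<^sub>m A ^\<^sub>m i * (k \<cdot>\<^sub>m A) = k ^ Suc i \<cdot>\<^sub>m (A ^\<^sub>m i * A)"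
    using A by (auto simp: mult_smult_distrib[of _ d d _ d] mult_smult_assoc_mat[of _ d d _ d]
      smult_smult_mat mult.commute)
  with Suc show ?case by simp
qed

context
  fixes B :: "'a mat"
  assumes B: "B \<in> carrier_mat d d" and AB: "A * B = B * A"
begin

lemma pow_mat_commute: "A ^\<^sub>m i * B = B * A ^\<^sub>m i"
proof -
  interpret M: semiring "ring_mat TYPE('a) d ()" by (rule semiring_mat)
  show ?thesis
    using A B AB M.group_commutes_pow[of A B i]
    by (simp add: pow_mat_ring_pow[OF A, where b = "()"] ring_mat_simps)
qed

lemma pow_mat_mult: "(A * B) ^\<^sub>m i = A ^\<^sub>m i * B ^\<^sub>m i"
proof -
  interpret M: semiring "ring_mat TYPE('a) d ()" by (rule semiring_mat)
  have "A * B \<in> carrier_mat d d" using A B by simp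
  then show ?thesis
    using A B AB M.pow_mult_distrib[of A B i]
    by (simp add: pow_mat_ring_pow[where n = d and b = "()"] ring_mat_simps)
qed

end

end

section \<open>Both sequences as multiples of powers of \<open>fib_mat a b 1\<close>\<close>

lemma fib_mat_carrier [simp]: "fib_mat a b n \<in> carrier_mat 2 2"
  by (simp add: fib_mat_def mat_of_rows_list_def numeral_2_eq_2)

lemma lucas_mat_carrier [simp]: "lucas_mat a b n \<in> carrier_mat 2 2"
  by (induction a b n rule: lucas_mat.induct) (auto simp: mat_of_rows_list_def numeral_2_eq_2)

lemma sum_lessThan_2: "(\<Sum>i = 0..<2::nat. f i) = f 0 + (f 1 :: 'a :: comm_monoid_add)"
  by (simp add: numeral_2_eq_2)

lemmas mat_2_simps = mat_of_rows_list_def scalar_prod_def less_Suc_eq less_2_cases_iff sum_lessThan_2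

lemma fib_mat_0: "fib_mat a b 0 = 1\<^sub>m 2"
  by (intro eq_matI) (auto simp: fib_mat_def eps_def biperiodic_fib_int_def mat_2_simps)

lemma fib_mat_1: "a \<noteq> 0 \<Longrightarrow> fib_mat a b 1 = mat_of_rows_list 2 [[b, b / a], [1, 0]]"
  by (simp add: fib_mat_def eps_def biperiodic_fib_int_def numeral_2_eq_2)

text \<open>Right multiplication by \<open>fib_mat a b 1\<close> always brings in the coefficient
  \<open>b\<close>. Where the recurrence of \<open>q\<close> asks for \<open>a\<close> instead, the
  identity \<open>b = (b / a) * a\<close> lets a factor \<open>b / a\<close> be pulled out of the
  entry. At \<open>n = 0\<close> the value of \<open>q\<close> at \<open>-1\<close> enters.\<close>

lemma fib_mat_mult_fib_mat_1:
  assumes "a \<noteq> 0"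
  shows "fib_mat a b n * fib_mat a b 1 = (b / a) ^ eps n \<cdot>\<^sub>m fib_mat a b (Suc n)"
proof -
  define q where "q = biperiodic_fib_int a b"
  have "q (int n + 2) = (if even n then a else b) * q (int n + 1) + q (int n)"
    using biperiodic_fib_int_rec[of "int n + 2" a b] by (simp add: q_def algebra_simps)
  moreover have "q (int n + 1) = (if even n then b else a) * q (int n) + q (int n - 1)"
    using biperiodic_fib_int_rec[of "int n + 1" a b] by (simp add: q_def algebra_simps)
  ultimately show ?thesis
    unfolding fib_mat_1[OF assms] unfolding fib_mat_def q_def[symmetric] using assms
    by (intro eq_matI)
      (auto simp: mat_2_simps eps_def field_simps)
qed

text \<open>This second-order form is what can be compared with the recurrence of
  \<open>lucas_mat\<close>. The diagonal entries obey the recurrence of \<open>q\<close> with the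
  other coefficient; the parity-dependent factor \<open>b / a\<close> on the diagonal corrects
  this.\<close>

lemma fib_mat_rec:
  assumes "a \<noteq> 0"
  shows "fib_mat a b (Suc (Suc n)) =
    (if even n then a else b) \<cdot>\<^sub>m fib_mat a b (Suc n) + fib_mat a b n"
proof -
  define q where "q = biperiodic_fib_int a b"
  have "q (int n + 3) = (if even n then b else a) * q (int n + 2) + q (int n + 1)"
    using biperiodic_fib_int_rec[of "int n + 3" a b] by (simp add: q_def algebra_simps)
  moreover have "q (int n + 2) = (if even n then a else b) * q (int n + 1) + q (int n)"
    using biperiodic_fib_int_rec[of "int n + 2" a b] by (simp add: q_def algebra_simps)
  moreover have "q (int n + 1) = (if even n then b else a) * q (int n) + q (int n - 1)"
    using biperiodic_fib_int_rec[of "int n + 1" a b] by (simp add: q_def algebra_simps)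
  ultimately show ?thesis
    unfolding fib_mat_def q_def[symmetric] using assms
    by (intro eq_matI)
      (auto simp: mat_2_simps eps_def algebra_simps)
qed

text \<open>Each multiplication by \<open>fib_mat a b 1\<close> that starts from an odd index
  contributes one factor \<open>b / a\<close>, and there are \<open>n div 2\<close> odd numbers
  below \<open>n\<close>.\<close>

lemma fib_mat_1_pow:
  assumes "a \<noteq> 0"
  shows "fib_mat a b 1 ^\<^sub>m n = (b / a) ^ (n div 2) \<cdot>\<^sub>m fib_mat a b n"
proof (induction n)
  case 0
  have "dim_row (fib_mat a b 1) = 2" using fib_mat_carrier by blast
  then show ?case by (auto simp: fib_mat_0)
next
  case (Suc n)
  have "n div 2 + eps n = Suc n div 2" by (simp add: eps_def)
  then have "(b / a) ^ (n div 2) * (b / a) ^ eps n = (b / a) ^ (Suc n div 2)"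
    by (metis power_add)
  with Suc show ?case
    using fib_mat_mult_fib_mat_1[OF assms, of b n]
    by (simp add: mult_smult_assoc_mat[of _ 2 2 _ 2] smult_smult_mat)
qed

lemma lucas_mat_0_mult_fib_mat_1:
  assumes "a \<noteq> 0" "b \<noteq> 0"
  shows "lucas_mat a b 0 * fib_mat a b 1 = (b / a) \<cdot>\<^sub>m lucas_mat a b 1"
  unfolding fib_mat_1[OF assms(1)] using assms
  by (intro eq_matI) (auto simp: mat_2_simps field_simps power2_eq_square)

lemma fib_mat_1_mult_lucas_mat_0:
  assumes "a \<noteq> 0" "b \<noteq> 0"
  shows "fib_mat a b 1 * lucas_mat a b 0 = lucas_mat a b 0 * fib_mat a b 1"
  unfolding fib_mat_1[OF assms(1)] using assms
  by (intro eq_matI) (auto simp: mat_2_simps field_simps)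

text \<open>No entry of the two initial matrices is computed beyond this point, so they stay
  folded.\<close>

declare lucas_mat.simps(1,2) [simp del]

text \<open>Two-step induction. The recurrences of \<open>fib_mat\<close> and
  \<open>lucas_mat\<close> have \<open>a\<close> and \<open>b\<close> interchanged; since
  \<open>a * (b / a) = b\<close>, the factor \<open>(b / a) ^ eps n\<close> absorbs the
  interchange.\<close>

lemma lucas_mat_0_mult_fib_mat:
  assumes "a \<noteq> 0" "b \<noteq> 0"
  shows "lucas_mat a b 0 * fib_mat a b n = (b / a) ^ eps n \<cdot>\<^sub>m lucas_mat a b n"
proof (induction n rule: induct_nat_012)
  case 0
  show ?case
    using right_mult_one_mat[OF lucas_mat_carrier[of a b 0]] by (simp add: fib_mat_0 eps_def)
next
  case 1
  show ?case using lucas_mat_0_mult_fib_mat_1[OF assms] by (simp add: eps_def)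
next
  case (ge2 n)
  have dim: "dim_row (lucas_mat a b k) = 2" "dim_col (lucas_mat a b k) = 2" for k
    using lucas_mat_carrier by blast+
  have "lucas_mat a b 0 * fib_mat a b (Suc (Suc n)) =
      (if even n then a else b) \<cdot>\<^sub>m (lucas_mat a b 0 * fib_mat a b (Suc n)) +
      lucas_mat a b 0 * fib_mat a b n"
    unfolding fib_mat_rec[OF assms(1)]
    by (simp add: mult_add_distrib_mat[of _ 2 2 _ 2] mult_smult_distrib[of _ 2 2 _ 2])
  also have "\<dots> = (b / a) ^ eps n \<cdot>\<^sub>m lucas_mat a b (Suc (Suc n))"
    unfolding ge2 using assms dim
    by (intro eq_matI)
      (auto simp: eps_def field_simps)
  finally show ?case by (simp add: eps_def)
qed

text \<open>Solved for \<open>fib_mat a b n\<close> with an integer exponent, so that later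
  comparisons of exponents are free of truncated subtraction.\<close>

lemma fib_mat_eq_pow:
  assumes "a \<noteq> 0" "b \<noteq> 0"
  shows "fib_mat a b n = (b / a) powi (- int (n div 2)) \<cdot>\<^sub>m (fib_mat a b 1 ^\<^sub>m n)"
  unfolding fib_mat_1_pow[OF assms(1)] using assms
  by (simp add: smult_smult_mat power_int_minus)

text \<open>The exponent is \<open>n div 2 + eps n\<close>: the first summand comes from
  \<open>fib_mat a b n\<close>, the second from its product with
  \<open>lucas_mat a b 0\<close>.\<close>

lemma lucas_mat_eq_pow:
  assumes "a \<noteq> 0" "b \<noteq> 0"
  shows "lucas_mat a b n =
    (b / a) powi (- int ((n + 1) div 2)) \<cdot>\<^sub>m (lucas_mat a b 0 * fib_mat a b 1 ^\<^sub>m n)"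
proof -
  have "(b / a) ^ (Suc n div 2) = (b / a) ^ (n div 2) * (b / a) ^ eps n"
    by (auto simp: eps_def elim!: oddE)
  then show ?thesis
    unfolding fib_mat_1_pow[OF assms(1)] using assms
    by (simp add: mult_smult_distrib[of _ 2 2 _ 2] lucas_mat_0_mult_fib_mat smult_smult_mat
      power_int_minus field_simps)
qed

section \<open>The identities, by comparison of exponents\<close>

theorem theorem3p3:
  fixes a b :: real and m n r :: nat
  assumes "a \<noteq> 0" and "b \<noteq> 0" and "r \<le> n"
  shows
    "fib_mat a b n ^\<^sub>m m = ((b / a) ^ (m div 2 * eps n)) \<cdot>\<^sub>m fib_mat a b (m * n) \<and>
     fib_mat a b (n + 1) ^\<^sub>m m =
       ((a / b) ^ ((m + 1) div 2 * eps n)) \<cdot>\<^sub>m ((fib_mat a b 1 ^\<^sub>m m) * fib_mat a b (m * n)) \<and>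
     fib_mat a b (n - r) * fib_mat a b (n + r) =
       ((b / a) ^ eps (n - r)) \<cdot>\<^sub>m (fib_mat a b 2 ^\<^sub>m n) \<and>
     ((b / a) ^ eps (n - r)) \<cdot>\<^sub>m (fib_mat a b 2 ^\<^sub>m n) =
       ((b / a) powi ((- 1) ^ n * int (eps r))) \<cdot>\<^sub>m (fib_mat a b n ^\<^sub>m 2) \<and>
     lucas_mat a b (n - r) * lucas_mat a b (n + r) =
       ((a / b) powi ((- 1) ^ n * int (eps r))) \<cdot>\<^sub>m (lucas_mat a b n ^\<^sub>m 2) \<and>
     (lucas_mat a b 0 ^\<^sub>m m) * fib_mat a b (m * n) =
       ((b / a) ^ ((m + 1) div 2 * eps n)) \<cdot>\<^sub>m (lucas_mat a b n ^\<^sub>m m)"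
proof -
  define c where "c = b / a"
  define P where "P = fib_mat a b 1"
  define L where "L = lucas_mat a b 0"
  have c: "c \<noteq> 0" using assms by (simp add: c_def)
  have ab: "a / b = inverse c" by (simp add: c_def)
  \<comment> \<open>Normal form for scalars: every power of \<open>c\<close> or
    \<open>inverse c\<close> becomes a single integer power of \<open>c\<close>.\<close>
  have cpow: "c powi x * c powi y = c powi (x + y)" "c ^ i = c powi int i"
    "inverse c powi x = c powi (- x)" "inverse c ^ i = c powi (- int i)" for x y i
    using c by (simp_all add: power_int_add power_int_minus power_int_inverse power_inverse)
  \<comment> \<open>Otherwise the simplifier would turn \<open>c powi int i\<close> back into a
    natural power.\<close>
  note [simp del] = power_int_of_nat and [simp] = mult_carrier_mat[of _ 2 2 _ 2]
  have P [simp]: "P \<in> carrier_mat 2 2" and L [simp]: "L \<in> carrier_mat 2 2"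
    by (simp_all add: P_def L_def)
  have PL: "P ^\<^sub>m i * L = L * P ^\<^sub>m i" for i
    by (rule pow_mat_commute[OF P L])
      (unfold P_def L_def, rule fib_mat_1_mult_lucas_mat_0[OF assms(1,2)])
  have F: "fib_mat a b k = c powi (- int (k div 2)) \<cdot>\<^sub>m P ^\<^sub>m k" for k
    unfolding c_def P_def by (rule fib_mat_eq_pow[OF assms(1,2)])
  have Lu: "lucas_mat a b k = c powi (- int ((k + 1) div 2)) \<cdot>\<^sub>m (L * P ^\<^sub>m k)" for k
    unfolding c_def P_def L_def by (rule lucas_mat_eq_pow[OF assms(1,2)])
  have Fpow: "fib_mat a b k ^\<^sub>m i = c powi (- int (k div 2 * i)) \<cdot>\<^sub>m P ^\<^sub>m (k * i)" for k i
    unfolding F by (simp add: pow_mat_smult[of _ 2] pow_mat_pow[OF P] power_int_power')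
  have Lpow: "lucas_mat a b k ^\<^sub>m i =
      c powi (- int ((k + 1) div 2 * i)) \<cdot>\<^sub>m (L ^\<^sub>m i * P ^\<^sub>m (k * i))" for k i
  proof -
    have "(L * P ^\<^sub>m k) ^\<^sub>m i = L ^\<^sub>m i * P ^\<^sub>m (k * i)"
      by (simp add: pow_mat_mult[of L 2] PL pow_mat_pow[OF P])
    then show ?thesis
      unfolding Lu
      by (simp add: pow_mat_smult[OF mult_carrier_mat[OF L pow_carrier_mat[OF P]]] power_int_power')
  qed
  have Fmult: "fib_mat a b i * fib_mat a b j =
      c powi (- int (j div 2) - int (i div 2)) \<cdot>\<^sub>m P ^\<^sub>m (i + j)" for i j
    unfolding F by (simp add: mult_smult_distrib[of _ 2 2 _ 2] mult_smult_assoc_mat[of _ 2 2 _ 2]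
      smult_smult_mat pow_mat_add[OF P] cpow)
  have Lmult: "lucas_mat a b i * lucas_mat a b j =
      c powi (- int ((j + 1) div 2) - int ((i + 1) div 2)) \<cdot>\<^sub>m (L ^\<^sub>m 2 * P ^\<^sub>m (i + j))" for i j
  proof -
    \<comment> \<open>Reassociation isolates the inner product \<open>P ^\<^sub>m i * L\<close>,
      which \<open>PL\<close> can then swap.\<close>
    have "L * P ^\<^sub>m i * (L * P ^\<^sub>m j) = L * (P ^\<^sub>m i * L) * P ^\<^sub>m j"
      by (simp add: assoc_mult_mat[of _ 2 2 _ 2 _ 2])
    also have "\<dots> = L * L * (P ^\<^sub>m i * P ^\<^sub>m j)"
      unfolding PL by (simp add: assoc_mult_mat[of _ 2 2 _ 2 _ 2])
    also have "\<dots> = L ^\<^sub>m 2 * P ^\<^sub>m (i + j)"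
      by (simp add: pow_mat_add[OF P] numeral_2_eq_2)
    finally show ?thesis
      unfolding Lu by (simp add: mult_smult_distrib[of _ 2 2 _ 2]
        mult_smult_assoc_mat[of _ 2 2 _ 2] smult_smult_mat cpow)
  qed
  \<comment> \<open>For \<open>n = 2 * k + 1\<close> the product is \<open>2 * m * k + m\<close>, so
    its half leaves the extra \<open>m div 2\<close>.\<close>
  have div_mult: "int (m * n div 2) = int m * int (n div 2) + int (m div 2) * int (eps n)"
  proof (cases "even n")
    case True
    then show ?thesis by (auto simp: eps_def elim!: evenE)
  next
    case False
    then obtain k where "n = 2 * k + 1" by (elim oddE)
    then have "m * n div 2 = m * k + m div 2" by (simp add: algebra_simps)
    with \<open>n = 2 * k + 1\<close> show ?thesis by (simp add: eps_def)
  qed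
  have half: "int ((k + 1) div 2) = int (k div 2) + int (eps k)" for k
    by (auto simp: eps_def elim!: oddE)
  have m_half: "int m = 2 * int (m div 2) + int (eps m)"
    by (auto simp: eps_def elim!: oddE)
  \<comment> \<open>The two indices have the same parity and sum to \<open>2 * n\<close>; if they
    are odd, each floor loses one half.\<close>
  have sum_div: "int ((n - r) div 2) + int ((n + r) div 2) = int n - int (eps (n - r))"
  proof -
    obtain d where "n = d + r" using assms(3) by (metis le_add_diff_inverse2)
    then show ?thesis by (auto simp: eps_def elim!: oddE evenE)
  qed
  have eps_sum: "eps (n + r) = eps (n - r)"
    using assms(3) by (simp add: eps_def)
  \<comment> \<open>Source of the sign \<open>(- 1) ^ n\<close>: an odd \<open>r\<close> flips the
    parity of \<open>n\<close>, which raises \<open>eps\<close> for even \<open>n\<close> and lowers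
    it for odd \<open>n\<close>.\<close>
  have eps_diff: "int (eps (n - r)) = int (eps n) + (- 1) ^ n * int (eps r)"
    using assms(3) by (auto simp: eps_def)
  have n_half: "2 * int (n div 2) = int n - int (eps n)"
    by (auto simp: eps_def elim!: oddE)
  \<comment> \<open>Shared by the power of \<open>fib_mat a b (n + 1)\<close> and the power of
    \<open>lucas_mat a b n\<close>, which carry the same exponent of \<open>c\<close>.\<close>
  have exp_m: "int ((n + 1) div 2) * int m =
      int ((m + 1) div 2) * int (eps n) + int (m * n div 2)"
  proof -
    have "int (eps n) * int m = int (eps n) * (2 * int (m div 2) + int (eps m))"
      using m_half by simp
    then show ?thesis unfolding half div_mult by (simp add: algebra_simps)
  qed
  have nr: "n - r + (n + r) = 2 * n" using assms(3) by simp
  have "fib_mat a b n ^\<^sub>m m = c ^ (m div 2 * eps n) \<cdot>\<^sub>m fib_mat a b (m * n)"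
    unfolding Fpow unfolding F by (simp add: smult_smult_mat cpow div_mult mult.commute)
  moreover have "fib_mat a b (n + 1) ^\<^sub>m m =
      inverse c ^ ((m + 1) div 2 * eps n) \<cdot>\<^sub>m (P ^\<^sub>m m * fib_mat a b (m * n))"
  proof -
    have "P ^\<^sub>m m * fib_mat a b (m * n) =
        c powi (- int (m * n div 2)) \<cdot>\<^sub>m P ^\<^sub>m ((n + 1) * m)"
      unfolding F by (simp add: mult_smult_distrib[of _ 2 2 _ 2] pow_mat_add[OF P] mult.commute)
    then show ?thesis
      unfolding Fpow by (simp only: smult_smult_mat cpow of_nat_mult exp_m) simp
  qed
  moreover have "fib_mat a b (n - r) * fib_mat a b (n + r) =
      c ^ eps (n - r) \<cdot>\<^sub>m fib_mat a b 2 ^\<^sub>m n"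
  proof -
    \<comment> \<open>The term \<open>2 div 2 * n\<close> is the exponent that \<open>Fpow\<close>
      yields at index 2, kept unevaluated so that the final rewriting matches it.\<close>
    have "- int ((n + r) div 2) - int ((n - r) div 2) = int (eps (n - r)) + - int (2 div 2 * n)"
      using sum_div by simp
    then show ?thesis
      unfolding Fmult Fpow nr by (simp only: smult_smult_mat cpow)
  qed
  moreover have "c ^ eps (n - r) \<cdot>\<^sub>m fib_mat a b 2 ^\<^sub>m n =
      c powi ((- 1) ^ n * int (eps r)) \<cdot>\<^sub>m fib_mat a b n ^\<^sub>m 2"
  proof -
    have "int (eps (n - r)) + - int (2 div 2 * n) =
        (- 1) ^ n * int (eps r) + - int (n div 2 * 2)"
      using eps_diff n_half by simp
    then show ?thesis
      unfolding Fpow by (simp only: smult_smult_mat cpow mult.commute[of n 2])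
  qed
  moreover have "lucas_mat a b (n - r) * lucas_mat a b (n + r) =
      inverse c powi ((- 1) ^ n * int (eps r)) \<cdot>\<^sub>m lucas_mat a b n ^\<^sub>m 2"
  proof -
    \<comment> \<open>Rounding up instead of down turns the sum \<open>n - eps (n - r)\<close> into
      \<open>n + eps (n - r)\<close>. This sign change is why \<open>a / b\<close> replaces
      \<open>b / a\<close> for the Lucas matrices.\<close>
    have "- int ((n + r + 1) div 2) - int ((n - r + 1) div 2) =
        - ((- 1) ^ n * int (eps r)) + - int ((n + 1) div 2 * 2)"
      unfolding half of_nat_mult using sum_div eps_sum eps_diff n_half by (simp add: algebra_simps)
    then show ?thesis
      unfolding Lmult Lpow nr by (simp only: smult_smult_mat cpow mult.commute[of n 2])
  qed
  moreover have "L ^\<^sub>m m * fib_mat a b (m * n) =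
      c ^ ((m + 1) div 2 * eps n) \<cdot>\<^sub>m lucas_mat a b n ^\<^sub>m m"
  proof -
    have "L ^\<^sub>m m * fib_mat a b (m * n) =
        c powi (- int (m * n div 2)) \<cdot>\<^sub>m (L ^\<^sub>m m * P ^\<^sub>m (n * m))"
      unfolding F by (simp add: mult_smult_distrib[of _ 2 2 _ 2] mult.commute)
    then show ?thesis
      unfolding Lpow by (simp only: smult_smult_mat cpow of_nat_mult exp_m) simp
  qed
  ultimately show ?thesis
    unfolding ab c_def[symmetric] P_def[symmetric] L_def[symmetric] by blast
qed

end
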